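(* Let $n\ge 1$, let $\mathcal{T}$ be an EW-tableau of size $n$, and let $\pi=\Psi(\mathcal{T})$ be its associated $n$-permutation. Then the set of nonzero row labels of $\mathcal{T}$ is exactly the set of descent bottoms of $\pi$, and thus exactly the set of excedance bottoms of $\mathrm{DE}(\pi)$.
   Context: A Ferrers diagram is a left-aligned array of cells whose row lengths weakly decrease from top to bottom (here all rows are nonempty). An EW-tableau is a 0/1-filling of a Ferrers diagram such that (1) the top row has a 1 in every cell; (2) every other row has at least one cell containing a 0; (3) no four cells that form the corners of a rectangle have 0s in two diagonally opposite corners and 1s in the other two. Its size is (number of rows) + (number of columns) $-1$. Labels: for an EW-tableau of size $n$, traverse the southeast border from the northeast corner to the southwest corner and number its unit steps $0,1,\dots,n$; the vertical step at the right end of a row is the label of that row and the horizontal step at the bottom of a column is the label of that column. The top row has label $0$. The cell in row $r$, column $c$ exists iff $r<c$. The map $\Psi$ from EW-tableaux of size $n$ to permutations of $\{1,\dots,n\}$: delete all entries of the top row and disregard the label 0. Then repeat the following two steps until all labels have been read (equivalently, all entries deleted): (i) write down the labels of all unread columns containing no 1s, one after the other from right to left (i.e. in increasing order), and delete the entries of these columns; (ii) write down the labels of all unread rows containing no 0s, one after the other from bottom to top (i.e. in decreasing order), and delete the entries of these rows. The resulting word is $\Psi(\mathcal{T})$. For a permutation $a_1\dots a_n$ of $\{1,\dots,n\}$: the descent bottoms are the letters $a_{i+1}$ with $a_i>a_{i+1}$, $1\le i<n$; the excedance bottoms are the indices $i$ with $a_i>i$. The bijection $\mathrm{DE}:\mathcal{S}_n\to\mathcal{S}_n$: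 for $\pi=a_1\dots a_n$ put $a_0=0$ and $\mathrm{DE}(\pi)=b_1\dots b_n$, where for each $1\le i\le n$: if $a_i>a_j$ for some $j>i$ then $b_{a_{i+1}}=a_i$; otherwise let $a_k$ ($0\le k<i$) be the rightmost letter smaller than $a_i$ and set $b_{a_{k+1}}=a_i$. *)

theory Defs
  imports Main "HOL-Library.While_Combinator"
begin

section \<open>Ferrers diagrams and EW-tableaux\<close>

text \<open>
  A Ferrers diagram is given by its list of row lengths, from top to bottom. Rows and columns are
  indexed from 0, so the cell in row \<open>i\<close> and column \<open>j\<close> exists iff \<open>j < sh ! i\<close>.
\<close>

definition ferrers_shape :: "nat list \<Rightarrow> bool" where
  "ferrers_shape sh \<longleftrightarrow> sh \<noteq> [] \<and> sorted_wrt (\<ge>) sh \<and> (\<forall>l\<in>set sh. 0 < l)"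

text \<open>A filling is the list of its rows; the entry in row \<open>i\<close>, column \<open>j\<close> is \<open>T ! i ! j\<close>.\<close>

definition ew_tableau :: "nat list list \<Rightarrow> bool" where
  "ew_tableau T \<longleftrightarrow>
     ferrers_shape (map length T) \<and>
     (\<forall>row\<in>set T. set row \<subseteq> {0, 1}) \<and>
     (\<forall>j<length (T ! 0). T ! 0 ! j = 1) \<and>
     (\<forall>i. 0 < i \<and> i < length T \<longrightarrow> (\<exists>j<length (T ! i). T ! i ! j = 0)) \<and>
     (\<forall>i i' j j'. i < i' \<and> i' < length T \<and> j < j' \<and> j' < length (T ! i) \<and> j' < length (T ! i') \<longrightarrow>
        \<not> (T ! i ! j = 0 \<and> T ! i' ! j' = 0 \<and> T ! i ! j' = 1 \<and> T ! i' ! j = 1) \<and>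
        \<not> (T ! i ! j = 1 \<and> T ! i' ! j' = 1 \<and> T ! i ! j' = 0 \<and> T ! i' ! j = 0))"

definition ew_size :: "nat list list \<Rightarrow> nat" where
  "ew_size T = length T + length (T ! 0) - 1"

section \<open>Labels\<close>

text \<open>
  \<open>VStep i\<close> is the vertical step at the right end of row \<open>i\<close>, and \<open>HStep j\<close> is the
  horizontal step at the bottom of column \<open>j\<close>.
\<close>

datatype border_step = VStep nat | HStep nat

text \<open>
  The southeast border from the northeast to the southwest corner. After the vertical step of
  row \<open>i\<close> come, from right to left, the bottoms of the columns that end in row \<open>i\<close>; the appended
  \<open>0\<close> is the length of the absent row below the last one.
\<close>

definition border :: "nat list \<Rightarrow> border_step list" where
  "border sh = concat (map (\<lambda>i. VStep i # map HStep (rev [(sh @ [0]) ! Suc i ..< sh ! i]))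
                           [0 ..< length sh])"

text \<open>The steps are numbered from 0, so a label is the number of steps that come before.\<close>

definition step_label :: "nat list list \<Rightarrow> border_step \<Rightarrow> nat" where
  "step_label T s = length (takeWhile (\<lambda>s'. s' \<noteq> s) (border (map length T)))"

definition row_label :: "nat list list \<Rightarrow> nat \<Rightarrow> nat" where
  "row_label T i = step_label T (VStep i)"

definition col_label :: "nat list list \<Rightarrow> nat \<Rightarrow> nat" where
  "col_label T j = step_label T (HStep j)"

definition row_labels :: "nat list list \<Rightarrow> nat set" where
  "row_labels T = row_label T ` {..<length T}"

section \<open>The map \<open>\<Psi>\<close>\<close>

text \<open>
  A state \<open>(R, C, w)\<close> consists of the unread rows, the unread columns and the word written so far.
  Reading a row or column deletes its entries, so the remaining entries are those of the cells
  in \<open>R \<times> C\<close>.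
\<close>

definition psi_step ::
  "nat list list \<Rightarrow> nat set \<times> nat set \<times> nat list \<Rightarrow> nat set \<times> nat set \<times> nat list" where
  "psi_step T = (\<lambda>(R, C, w).
     let cs = {j \<in> C. \<forall>i\<in>R. j < length (T ! i) \<longrightarrow> T ! i ! j \<noteq> 1};
         C' = C - cs;
         rs = {i \<in> R. \<forall>j\<in>C'. j < length (T ! i) \<longrightarrow> T ! i ! j \<noteq> 0}
     in (R - rs, C',
         w @ map (col_label T) (rev (sorted_list_of_set cs))
           @ map (row_label T) (rev (sorted_list_of_set rs))))"

text \<open>The top row (index 0) is absent from the initial state.\<close>

definition Psi :: "nat list list \<Rightarrow> nat list" where
  "Psi T = (case while (\<lambda>(R, C, w). R \<noteq> {} \<or> C \<noteq> {}) (psi_step T)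
                   ({1..<length T}, {..<length (T ! 0)}, [])
            of (R, C, w) \<Rightarrow> w)"

section \<open>Permutations in one-line notation\<close>

text \<open>The letter \<open>a\<^sub>i\<close> of the word \<open>a\<^sub>1 \<dots> a\<^sub>n\<close>, with the convention \<open>a\<^sub>0 = 0\<close>.\<close>

definition letter :: "nat list \<Rightarrow> nat \<Rightarrow> nat" where
  "letter p i = (0 # p) ! i"

definition descent_bottoms :: "nat list \<Rightarrow> nat set" where
  "descent_bottoms p = {letter p (i + 1) | i. 1 \<le> i \<and> i < length p \<and> letter p i > letter p (i + 1)}"

definition excedance_bottoms :: "nat list \<Rightarrow> nat set" where
  "excedance_bottoms p = {i. 1 \<le> i \<and> i \<le> length p \<and> letter p i > i}"

text \<open>The index \<open>m\<close> for which the definition of \<open>DE\<close> prescribes \<open>b\<^sub>m = a\<^sub>i\<close>.\<close>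

definition DE_pos :: "nat list \<Rightarrow> nat \<Rightarrow> nat" where
  "DE_pos p i =
     (if \<exists>j. i < j \<and> j \<le> length p \<and> letter p i > letter p j
      then letter p (i + 1)
      else letter p (Max {k. k < i \<and> letter p k < letter p i} + 1))"

definition DE :: "nat list \<Rightarrow> nat list" where
  "DE p = map (\<lambda>m. THE b. \<exists>i. 1 \<le> i \<and> i \<le> length p \<and> DE_pos p i = m \<and> b = letter p i)
              [1 ..< length p + 1]"

end

theory Submission
  imports Defs
begin

text \<open>
  \<^bold>\<open>The word of a tableau.\<close> The map \<open>\<Psi>\<close> writes alternating blocks of column labels, increasing, and
  of row labels, decreasing. Inside a block, the claim that exactly the row labels are descent
  bottoms is clear, so only the seams between blocks matter. A row other than the top one contains
  a \<open>0\<close> and is read as soon as its last \<open>0\<close> has been deleted, so it has a cell in some column of the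
  block just written; its label is below the label of that column, hence below the last letter of
  the block. Dually, a column outside the first block is read once its last \<open>1\<close> has been deleted,
  so it has a cell in some row of the block just written, and its label exceeds the last letter of
  that block. All of this is an invariant of the loop (\<open>psi_inv\<close>, \<open>psi_inv_step\<close>), stated for the
  word with a \<open>0\<close> in front: the letter \<open>0\<close> lies below every column label, so the start behaves like
  any other seam.

  The argument needs that no column block is empty, and that the loop ends. Both follow from
  \<open>ew_progress\<close>: a nonempty set of unread rows and columns contains a row without \<open>0\<close>s or a column
  without \<open>1\<close>s. If the cells are the edges of a bipartite graph on rows and columns, a \<open>0\<close> being
  oriented from its row to its column and a \<open>1\<close> the other way, this says that every nonempty
  induced subgraph has a sink; the rectangle condition excludes directed 4-cycles, and on a Ferrers
  diagram this excludes all cycles.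

  \<^bold>\<open>The bijection \<open>DE\<close>.\<close> For any permutation, the index at which \<open>a\<^sub>i\<close> is placed is itself a letter
  \<open>a\<^sub>m\<close>, and different \<open>i\<close> give different \<open>m\<close> (\<open>inj_on_DE_src\<close>), so every index receives exactly one
  letter. If \<open>a\<^sub>i\<close> has a smaller letter to its right, it is placed at the index \<open>a\<^sub>i\<^sub>+\<^sub>1\<close>, which is an
  excedance bottom exactly when \<open>i\<close> is a descent; otherwise \<open>i\<close> is not a descent and \<open>a\<^sub>i\<close> is placed
  at an index at least \<open>a\<^sub>i\<close> (\<open>DE_pos_less_iff_descent\<close>, \<open>excedance_bottoms_DE\<close>).
\<close>

section \<open>Cells and rectangles of EW-tableaux\<close>

lemma ferrers_shape_antimono:
  assumes "ferrers_shape sh" "i \<le> i'" "i' < length sh"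
  shows "sh ! i' \<le> sh ! i"
  using assms by (cases "i = i'") (auto simp: ferrers_shape_def sorted_wrt_iff_nth_less)

lemma ew_row_length_antimono:
  assumes "ew_tableau T" "i \<le> i'" "i' < length T"
  shows "length (T ! i') \<le> length (T ! i)"
  using ferrers_shape_antimono[of "map length T" i i'] assms by (simp add: ew_tableau_def)

lemma ew_nonempty: "ew_tableau T \<Longrightarrow> T \<noteq> []"
  by (auto simp: ew_tableau_def ferrers_shape_def)

lemma ew_entry_zero:
  assumes "ew_tableau T" "i < length T" "j < length (T ! i)" "T ! i ! j \<noteq> 1"
  shows "T ! i ! j = 0"
proof -
  have "set (T ! i) \<subseteq> {0, 1}"
    using assms(1,2) nth_mem unfolding ew_tableau_def by blast
  then show ?thesis
    using nth_mem[OF assms(3)] assms(4) by auto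
qed

text \<open>
  The two forbidden patterns are mirror images of each other, so together they forbid one pattern
  for columns in either order; it suffices that the lower row meets both columns.
\<close>

lemma ew_no_rectangle:
  assumes "ew_tableau T" "i < i'" "i' < length T" "j < length (T ! i')" "j' < length (T ! i')"
    and "T ! i ! j = 0" "T ! i' ! j = 1" "T ! i ! j' = 1" "T ! i' ! j' = 0"
  shows False
proof -
  have len: "length (T ! i') \<le> length (T ! i)"
    using ew_row_length_antimono assms(1-3) by simp
  have rect: "\<not> (T ! i ! k = 0 \<and> T ! i' ! k' = 0 \<and> T ! i ! k' = 1 \<and> T ! i' ! k = 1) \<and>
        \<not> (T ! i ! k = 1 \<and> T ! i' ! k' = 1 \<and> T ! i ! k' = 0 \<and> T ! i' ! k = 0)"
    if "k < k'" "k' < length (T ! i')" for k k'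
    using assms(1-3) that len unfolding ew_tableau_def by (meson less_le_trans)
  have "j \<noteq> j'"
    using assms by auto
  then consider "j < j'" | "j' < j"
    by linarith
  then show False
    using rect[of j j'] rect[of j' j] assms by cases auto
qed

text \<open>
  The hypotheses survive the removal of the bottom row \<open>b\<close>, because no column loses its only \<open>1\<close>.
  Indeed \<open>b\<close> has a \<open>0\<close> in some column \<open>j'\<close>, which has a \<open>1\<close> in a higher row \<open>i\<close>. If \<open>b\<close> were the
  only row with a \<open>1\<close> in column \<open>j\<close>, then \<open>i\<close>, being at least as long as \<open>b\<close>, would have a \<open>0\<close>
  there, and the rows \<open>i, b\<close> and columns \<open>j, j'\<close> would form a forbidden rectangle. Removing rows
  in this way, all rows disappear while the columns still have \<open>1\<close>s.
\<close>

lemma ew_progress: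
  assumes "ew_tableau T" "finite R" "R \<subseteq> {..<length T}"
    and "\<forall>i\<in>R. \<exists>j\<in>C. j < length (T ! i) \<and> T ! i ! j = 0"
    and "\<forall>j\<in>C. \<exists>i\<in>R. j < length (T ! i) \<and> T ! i ! j = 1"
  shows "R = {} \<and> C = {}"
  using assms(2-)
proof (induction R rule: finite_linorder_max_induct)
  case empty
  then show ?case by auto
next
  case (insert b R)
  have b: "b < length T"
    using insert.prems by auto
  have "\<exists>i\<in>R. j < length (T ! i) \<and> T ! i ! j = 1" if "j \<in> C" for j
  proof (rule ccontr)
    assume no_one: "\<not> ?thesis"
    then have j: "j < length (T ! b)" "T ! b ! j = 1"
      using insert.prems(3) that by auto
    obtain j' where j': "j' \<in> C" "j' < length (T ! b)" "T ! b ! j' = 0"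
      using insert.prems(2) by auto
    then obtain i where i: "i \<in> R" "T ! i ! j' = 1"
      using insert.prems(3) by force
    have ib: "i < b"
      using i insert.hyps by auto
    then have "j < length (T ! i)"
      using ew_row_length_antimono[OF assms(1), of i b] b j by simp
    then have "T ! i ! j = 0"
      using ew_entry_zero[OF assms(1), of i j] no_one i ib b by auto
    then show False
      using ew_no_rectangle[OF assms(1) ib b] j j' i by blast
  qed
  then have "C = {}"
    using insert.IH insert.prems by auto
  then show ?case
    using insert.prems by auto
qed

section \<open>Labels along the border\<close>

text \<open>
  A description of the order of the border steps that does not refer to the list: a vertical step
  precedes a horizontal one iff the diagram has the cell in that row and column.
\<close>

fun border_before :: "nat list \<Rightarrow> border_step \<Rightarrow> border_step \<Rightarrow> bool" where
  "border_before sh (VStep i) (VStep i') \<longleftrightarrow> i < i'"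
| "border_before sh (VStep i) (HStep j) \<longleftrightarrow> j < sh ! i"
| "border_before sh (HStep j) (VStep i) \<longleftrightarrow> sh ! i \<le> j"
| "border_before sh (HStep j) (HStep j') \<longleftrightarrow> j' < j"

lemma border_before_asym: "border_before sh s s' \<Longrightarrow> \<not> border_before sh s' s"
  by (cases s; cases s') auto

text \<open>
  The steps of the first \<open>k\<close> rows end at the column where row \<open>k\<close> ends, so the steps added by
  row \<open>k\<close> come later in each of the four cases.
\<close>

lemma border_prefix:
  assumes "ferrers_shape sh" "k \<le> length sh"
  defines "block \<equiv> \<lambda>i. VStep i # map HStep (rev [(sh @ [0]) ! Suc i ..< sh ! i])"
  shows "sorted_wrt (border_before sh) (concat (map block [0..<k])) \<and>
         set (concat (map block [0..<k])) = VStep ` {..<k} \<union> HStep ` {(sh @ [0]) ! k ..< sh ! 0}"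
  using assms(2)
proof (induction k)
  case 0
  then show ?case
    using assms(1) by (simp add: ferrers_shape_def nth_append)
next
  case (Suc k)
  let ?pre = "concat (map block [0..<k])"
  have mono: "sh ! k \<le> sh ! i" if "i \<le> k" for i
    using ferrers_shape_antimono[OF assms(1)] that Suc.prems by simp
  have next_le: "(sh @ [0]) ! Suc k \<le> sh ! k"
    using ferrers_shape_antimono[OF assms(1), of k "Suc k"] Suc.prems by (auto simp: nth_append)
  have k: "(sh @ [0]) ! k = sh ! k"
    using Suc.prems by (simp add: nth_append)
  have IH: "sorted_wrt (border_before sh) ?pre"
      "set ?pre = VStep ` {..<k} \<union> HStep ` {sh ! k ..< sh ! 0}"
    using Suc k by auto
  have split: "concat (map block [0..<Suc k]) = ?pre @ block k"
    by simp
  have block_set: "set (block k) = insert (VStep k) (HStep ` {(sh @ [0]) ! Suc k ..< sh ! k})"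
    by (simp add: block_def)
  have "sorted_wrt (border_before sh) (block k)"
    by (auto simp: block_def sorted_wrt_map sorted_wrt_rev)
  moreover have "border_before sh s s'" if "s \<in> set ?pre" "s' \<in> set (block k)" for s s'
    using that unfolding IH block_set by (auto intro: less_le_trans[OF _ mono[OF less_imp_le]])
  ultimately have "sorted_wrt (border_before sh) (?pre @ block k)"
    using IH(1) unfolding sorted_wrt_append by blast
  moreover have "set (?pre @ block k) =
      VStep ` {..<Suc k} \<union> HStep ` {(sh @ [0]) ! Suc k ..< sh ! 0}"
  proof -
    have "{(sh @ [0]) ! Suc k ..< sh ! 0} = {(sh @ [0]) ! Suc k ..< sh ! k} \<union> {sh ! k ..< sh ! 0}"
      using next_le mono[of 0] by auto
    then show ?thesis
      unfolding set_append IH block_set by (auto simp: lessThan_Suc)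
  qed
  ultimately show ?case
    unfolding split by blast
qed

lemma border_sorted:
  "ferrers_shape sh \<Longrightarrow> sorted_wrt (border_before sh) (border sh)"
  using border_prefix[of sh "length sh"] by (simp add: border_def)

lemma set_border:
  "ferrers_shape sh \<Longrightarrow> set (border sh) = VStep ` {..<length sh} \<union> HStep ` {..<sh ! 0}"
  using border_prefix[of sh "length sh"] by (simp add: border_def atLeast0LessThan)

lemma distinct_border: "ferrers_shape sh \<Longrightarrow> distinct (border sh)"
  unfolding distinct_conv_nth using border_sorted[of sh]
  by (metis border_before_asym linorder_neqE_nat sorted_wrt_iff_nth_less)

lemma step_label_nth:
  assumes "ferrers_shape (map length T)" "k < length (border (map length T))"
  shows "step_label T (border (map length T) ! k) = k"
proof -
  let ?b = "border (map length T)"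
  have "takeWhile (\<lambda>s. s \<noteq> ?b ! k) ?b = take k ?b"
    using distinct_border[OF assms(1)] assms(2)
    by (intro takeWhile_eq_take_P_nth) (auto simp: nth_eq_iff_index_eq)
  then show ?thesis
    using assms(2) by (simp add: step_label_def)
qed

lemma step_label_less:
  assumes "ferrers_shape (map length T)"
    and "s \<in> set (border (map length T))" "s' \<in> set (border (map length T))"
    and "border_before (map length T) s s'"
  shows "step_label T s < step_label T s'"
proof -
  let ?b = "border (map length T)"
  obtain k k' where k: "k < length ?b" "s = ?b ! k" "k' < length ?b" "s' = ?b ! k'"
    using assms(2,3) by (metis in_set_conv_nth)
  have "k < k'"
  proof (rule ccontr)
    assume "\<not> k < k'"
    then have "k' = k \<or> border_before (map length T) s' s"
      using border_sorted[OF assms(1)] k unfolding sorted_wrt_iff_nth_less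
      by (metis linorder_neqE_nat)
    then show False
      using assms(4) border_before_asym k by blast
  qed
  then show ?thesis
    using k step_label_nth[OF assms(1)] by simp
qed

lemma bij_betw_step_label:
  assumes "ew_tableau T"
  shows "bij_betw (step_label T) (VStep ` {..<length T} \<union> HStep ` {..<length (T ! 0)})
           {..ew_size T}"
proof -
  let ?b = "border (map length T)"
  have fs: "ferrers_shape (map length T)"
    using assms by (simp add: ew_tableau_def)
  have T: "T \<noteq> []"
    using ew_nonempty assms .
  have set_b: "set ?b = VStep ` {..<length T} \<union> HStep ` {..<length (T ! 0)}"
    using set_border[OF fs] T by simp
  have "length ?b = card (set ?b)"
    using distinct_border[OF fs] by (simp add: distinct_card)
  also have "\<dots> = length T + length (T ! 0)"
    unfolding set_b by (subst card_Un_disjoint) (auto simp: card_image inj_on_def)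
  finally have len: "{..ew_size T} = {..<length ?b}"
    using T by (cases T) (auto simp: ew_size_def)
  have "bij_betw (step_label T) (set ?b) {..<length ?b}"
  proof (rule bij_betw_byWitness[where f' = "(!) ?b"])
    show "\<forall>s\<in>set ?b. ?b ! step_label T s = s"
      using step_label_nth[OF fs] by (metis in_set_conv_nth)
    show "step_label T ` set ?b \<subseteq> {..<length ?b}"
      using step_label_nth[OF fs] by (auto simp: in_set_conv_nth)
  qed (use step_label_nth[OF fs] in auto)
  then show ?thesis
    unfolding set_b len .
qed

lemma row_label_strict_mono:
  assumes "ew_tableau T" "i < i'" "i' < length T"
  shows "row_label T i < row_label T i'"
  unfolding row_label_def using assms ew_nonempty[OF assms(1)]
  by (intro step_label_less) (auto simp: ew_tableau_def set_border)

lemma col_label_strict_antimono: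
  assumes "ew_tableau T" "j < j'" "j' < length (T ! 0)"
  shows "col_label T j' < col_label T j"
  unfolding col_label_def using assms ew_nonempty[OF assms(1)]
  by (intro step_label_less) (auto simp: ew_tableau_def set_border)

lemma row_label_less_col_label:
  assumes "ew_tableau T" "i < length T" "j < length (T ! i)"
  shows "row_label T i < col_label T j"
proof -
  have "j < length (T ! 0)"
    using ew_row_length_antimono[OF assms(1), of 0 i] assms by simp
  then show ?thesis
    unfolding row_label_def col_label_def using assms ew_nonempty[OF assms(1)]
    by (intro step_label_less) (auto simp: ew_tableau_def set_border)
qed

lemma inj_on_row_label: "ew_tableau T \<Longrightarrow> inj_on (row_label T) {..<length T}"
  by (rule linorder_inj_onI') (metis lessThan_iff less_irrefl row_label_strict_mono)

lemma inj_on_col_label: "ew_tableau T \<Longrightarrow> inj_on (col_label T) {..<length (T ! 0)}"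
  by (rule linorder_inj_onI') (metis lessThan_iff less_irrefl col_label_strict_antimono)

lemma col_label_notin_row_labels:
  assumes "ew_tableau T" "j < length (T ! 0)"
  shows "col_label T j \<notin> row_labels T"
proof
  assume "col_label T j \<in> row_labels T"
  then obtain i where "i < length T" "step_label T (HStep j) = step_label T (VStep i)"
    by (auto simp: row_labels_def row_label_def col_label_def)
  then have "HStep j = VStep i"
    using bij_betw_imp_inj_on[OF bij_betw_step_label[OF assms(1)]] assms(2)
    by (auto dest!: inj_onD)
  then show False by simp
qed

lemma labels_eq:
  assumes "ew_tableau T"
  shows "row_label T ` {..<length T} \<union> col_label T ` {..<length (T ! 0)} = {..ew_size T}"
  using bij_betw_imp_surj_on[OF bij_betw_step_label[OF assms]]
  by (simp add: image_Un image_image row_label_def col_label_def)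

text \<open>Every other label is larger than the label of the top row.\<close>

lemma row_label_top:
  assumes "ew_tableau T"
  shows "row_label T 0 = 0"
proof -
  have "0 \<in> row_label T ` {..<length T} \<union> col_label T ` {..<length (T ! 0)}"
    unfolding labels_eq[OF assms] by simp
  then obtain s where "(s < length T \<and> row_label T s = 0) \<or> (s < length (T ! 0) \<and> col_label T s = 0)"
    by (metis UnE imageE lessThan_iff)
  then show ?thesis
    using row_label_strict_mono[OF assms, of 0 s] row_label_less_col_label[OF assms, of 0 s]
      ew_nonempty[OF assms] by (cases s) auto
qed

lemma row_labels_nonzero:
  assumes "ew_tableau T"
  shows "row_labels T - {0} = row_label T ` {1..<length T}"
proof -
  have "{..<length T} = insert 0 {1..<length T}"
    using ew_nonempty[OF assms] by (auto simp: Suc_le_eq)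
  then have "row_labels T = insert 0 (row_label T ` {1..<length T})"
    unfolding row_labels_def using row_label_top[OF assms] by (metis image_insert)
  moreover have "0 < row_label T i" if "i \<in> {1..<length T}" for i
    using row_label_strict_mono[OF assms, of 0 i] that by simp
  then have "0 \<notin> row_label T ` {1..<length T}"
    by (metis image_iff less_irrefl)
  ultimately show ?thesis
    by simp
qed

lemma nonzero_labels_eq:
  assumes "ew_tableau T"
  shows "row_label T ` {1..<length T} \<union> col_label T ` {..<length (T ! 0)} = {1..ew_size T}"
proof -
  have "0 \<notin> col_label T ` {..<length (T ! 0)}"
    using row_label_less_col_label[OF assms, of 0] ew_nonempty[OF assms] by fastforce
  then have "row_label T ` {1..<length T} \<union> col_label T ` {..<length (T ! 0)}
      = (row_labels T \<union> col_label T ` {..<length (T ! 0)}) - {0}"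
    using row_labels_nonzero[OF assms] by auto
  also have "\<dots> = {1..ew_size T}"
    using labels_eq[OF assms] by (auto simp: row_labels_def)
  finally show ?thesis .
qed

section \<open>The word of a tableau\<close>

text \<open>
  The third condition makes the next column block nonempty; the fourth is the seam between the word
  and that block. The pattern of descents is imposed on \<open>0 # w\<close>, which also keeps row labels out of
  the first position.
\<close>

definition psi_inv :: "nat list list \<Rightarrow> nat set \<times> nat set \<times> nat list \<Rightarrow> bool" where
  "psi_inv T = (\<lambda>(R, C, w).
     R \<subseteq> {1..<length T} \<and> C \<subseteq> {..<length (T ! 0)} \<and>
     (\<forall>i\<in>R. \<exists>j\<in>C. j < length (T ! i) \<and> T ! i ! j = 0) \<and>
     (\<forall>j\<in>C. (\<forall>i\<in>R. j < length (T ! i) \<longrightarrow> T ! i ! j \<noteq> 1) \<longrightarrow> last (0 # w) < col_label T j) \<and>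
     successively (\<lambda>a b. a > b \<longleftrightarrow> b \<in> row_labels T - {0}) (0 # w) \<and>
     distinct w \<and>
     set w = row_label T ` ({1..<length T} - R) \<union> col_label T ` ({..<length (T ! 0)} - C))"

lemma psi_inv_init:
  assumes "ew_tableau T"
  shows "psi_inv T ({1..<length T}, {..<length (T ! 0)}, [])"
proof -
  have "\<exists>j\<in>{..<length (T ! 0)}. j < length (T ! i) \<and> T ! i ! j = 0"
    if i: "i \<in> {1..<length T}" for i
  proof -
    have "\<forall>i. 0 < i \<and> i < length T \<longrightarrow> (\<exists>j<length (T ! i). T ! i ! j = 0)"
      using assms unfolding ew_tableau_def by (elim conjE)
    moreover have "0 < i" "i < length T"
      using i by auto
    ultimately obtain j where "j < length (T ! i)" "T ! i ! j = 0"
      by blast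
    then show ?thesis
      using ew_row_length_antimono[OF assms, of 0 i] i by (intro bexI[of _ j]) auto
  qed
  moreover have "0 < col_label T j" if "j < length (T ! 0)" for j
    using row_label_less_col_label[OF assms, of 0 j] ew_nonempty[OF assms] that by simp
  ultimately show ?thesis
    unfolding psi_inv_def by simp
qed

lemma sorted_wrt_le_last: "sorted_wrt (<) xs \<Longrightarrow> x \<in> set xs \<Longrightarrow> x \<le> (last xs :: nat)"
  by (induction xs) (auto simp: le_less)

lemma sorted_wrt_last_le: "sorted_wrt (>) xs \<Longrightarrow> x \<in> set xs \<Longrightarrow> (last xs :: nat) \<le> x"
  by (induction xs) (auto simp: le_less)

lemma sorted_col_labels:
  assumes "ew_tableau T" "cs \<subseteq> {..<length (T ! 0)}"
  shows "sorted_wrt (<) (map (col_label T) (rev (sorted_list_of_set cs)))"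
proof -
  have "finite cs"
    using assms(2) finite_subset by blast
  then show ?thesis
    using assms unfolding sorted_wrt_map sorted_wrt_rev
    by (intro sorted_wrt_mono_rel[OF _ strict_sorted_list_of_set])
       (auto intro!: col_label_strict_antimono)
qed

lemma sorted_row_labels:
  assumes "ew_tableau T" "rs \<subseteq> {..<length T}"
  shows "sorted_wrt (>) (map (row_label T) (rev (sorted_list_of_set rs)))"
proof -
  have "finite rs"
    using assms(2) finite_subset by blast
  then show ?thesis
    using assms unfolding sorted_wrt_map sorted_wrt_rev
    by (intro sorted_wrt_mono_rel[OF _ strict_sorted_list_of_set])
       (auto intro!: row_label_strict_mono)
qed

lemma psi_inv_step:
  assumes T: "ew_tableau T" and inv: "psi_inv T (R, C, w)" and ne: "R \<noteq> {} \<or> C \<noteq> {}"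
  shows "psi_inv T (psi_step T (R, C, w))"
    and "(psi_step T (R, C, w), (R, C, w)) \<in> measure (\<lambda>(R, C, w). card R + card C)"
proof -
  define cs where "cs = {j \<in> C. \<forall>i\<in>R. j < length (T ! i) \<longrightarrow> T ! i ! j \<noteq> 1}"
  define rs where "rs = {i \<in> R. \<forall>j\<in>C - cs. j < length (T ! i) \<longrightarrow> T ! i ! j \<noteq> 0}"
  define A where "A = map (col_label T) (rev (sorted_list_of_set cs))"
  define B where "B = map (row_label T) (rev (sorted_list_of_set rs))"
  let ?P = "\<lambda>a b. a > b \<longleftrightarrow> b \<in> row_labels T - {0}"
  have step: "psi_step T (R, C, w) = (R - rs, C - cs, w @ A @ B)"
    by (simp add: psi_step_def cs_def rs_def A_def B_def Let_def)
  have R: "R \<subseteq> {1..<length T}" and C: "C \<subseteq> {..<length (T ! 0)}"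
    and zero: "\<forall>i\<in>R. \<exists>j\<in>C. j < length (T ! i) \<and> T ! i ! j = 0"
    and seam: "\<forall>j\<in>cs. last (0 # w) < col_label T j"
    and succ: "successively ?P (0 # w)" and dist: "distinct w"
    and set_w: "set w = row_label T ` ({1..<length T} - R) \<union> col_label T ` ({..<length (T ! 0)} - C)"
    using inv by (auto simp: psi_inv_def cs_def)
  have fin: "finite R" "finite C"
    using R C finite_subset by blast+
  have cs: "cs \<subseteq> C" "finite cs" and rs: "rs \<subseteq> R" "finite rs"
    using fin by (auto simp: cs_def rs_def)
  have cs_ne: "cs \<noteq> {}"
  proof
    assume "cs = {}"
    then have "R = {} \<and> C = {}"
      using zero R fin by (intro ew_progress[OF T]) (auto simp: cs_def)
    then show False
      using ne by simp
  qed
  then have "card (C - cs) < card C" "card (R - rs) \<le> card R"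
    using fin cs by (auto intro: psubset_card_mono card_mono)
  then show "(psi_step T (R, C, w), (R, C, w)) \<in> measure (\<lambda>(R, C, w). card R + card C)"
    unfolding step by simp

  have set_A: "set A = col_label T ` cs" and set_B: "set B = row_label T ` rs"
    using cs rs by (auto simp: A_def B_def)
  have "cs \<subseteq> {..<length (T ! 0)}" "rs \<subseteq> {..<length T}"
    using cs rs R C by auto
  then have A_sorted: "sorted_wrt (<) A" and B_sorted: "sorted_wrt (>) B"
    unfolding A_def B_def using sorted_col_labels[OF T] sorted_row_labels[OF T] by blast+
  have A_ne: "A \<noteq> []"
    using cs_ne cs by (simp add: A_def)
  have A_labels: "a \<notin> row_labels T" if "a \<in> set A" for a
    using that set_A cs C col_label_notin_row_labels[OF T] by auto
  have B_labels: "b \<in> row_labels T - {0}" if "b \<in> set B" for b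
    using that set_B rs R row_labels_nonzero[OF T] by auto

  \<comment> \<open>A row of \<open>rs\<close> still had a \<open>0\<close> before the columns \<open>cs\<close> were deleted, so it has a cell in one of them.\<close>
  have A_above_B: "b < last A" if b: "b \<in> set B" for b
  proof -
    obtain i where i: "i \<in> rs" "b = row_label T i"
      using b set_B by auto
    then obtain j where j: "j \<in> cs" "j < length (T ! i)"
      using zero unfolding rs_def by blast
    have "row_label T i < col_label T j"
      using row_label_less_col_label[OF T] i j rs R by auto
    also have "\<dots> \<le> last A"
      using sorted_wrt_le_last[OF A_sorted] j set_A by simp
    finally show ?thesis
      using i by simp
  qed

  \<comment> \<open>A column of \<open>C - cs\<close> without \<open>1\<close>s in the remaining rows still had a \<open>1\<close> before the rows \<open>rs\<close> were
    deleted, so it has a cell in one of them.\<close>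
  have next_seam: "last (0 # w @ A @ B) < col_label T j"
    if j: "j \<in> C - cs" and no_one: "\<forall>i\<in>R - rs. j < length (T ! i) \<longrightarrow> T ! i ! j \<noteq> 1" for j
  proof -
    obtain i where i: "i \<in> rs" "j < length (T ! i)"
      using j no_one unfolding cs_def by blast
    then have in_B: "row_label T i \<in> set B"
      using set_B by simp
    then have "B \<noteq> []"
      by auto
    then have "last (0 # w @ A @ B) = last B"
      by simp
    also have "\<dots> \<le> row_label T i"
      using sorted_wrt_last_le[OF B_sorted in_B] .
    also have "\<dots> < col_label T j"
      using row_label_less_col_label[OF T] i rs R by auto
    finally show ?thesis .
  qed

  have "successively ?P A"
    using A_sorted A_labels
    by (intro successively_if_sorted_wrt) (auto elim!: sorted_wrt_mono_rel[rotated])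
  moreover have "successively ?P B"
    using B_sorted B_labels
    by (intro successively_if_sorted_wrt) (auto elim!: sorted_wrt_mono_rel[rotated])
  moreover have "?P (last (0 # w)) (hd A)"
  proof -
    have "hd A \<in> set A"
      using A_ne by simp
    then have "last (0 # w) < hd A" "hd A \<notin> row_labels T"
      using seam set_A A_labels by auto
    then show ?thesis
      by (metis DiffD1 less_asym)
  qed
  moreover have "B = [] \<or> ?P (last A) (hd B)"
    using A_above_B[of "hd B"] B_labels[of "hd B"] by (cases B) auto
  ultimately have succ': "successively ?P (0 # w @ A @ B)"
    using succ unfolding append_Cons[symmetric] successively_append_iff
    by (metis hd_append2 A_ne)

  have "{1..<length T} - (R - rs) = ({1..<length T} - R) \<union> rs"
    "{..<length (T ! 0)} - (C - cs) = ({..<length (T ! 0)} - C) \<union> cs"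
    using cs rs R C by auto
  then have set_w': "set (w @ A @ B) = row_label T ` ({1..<length T} - (R - rs)) \<union>
      col_label T ` ({..<length (T ! 0)} - (C - cs))"
    by (simp add: set_w set_A set_B image_Un Un_ac)

  have "sorted_wrt (<) (rev B)"
    using B_sorted by (simp add: sorted_wrt_rev)
  then have "distinct A" "distinct B"
    using A_sorted by (simp_all add: strict_sorted_iff)
  moreover have "set A \<inter> set B = {}"
    using A_labels B_labels by blast
  moreover have "set w \<inter> set A = {}"
  proof -
    have "col_label T ` ({..<length (T ! 0)} - C) \<inter> col_label T ` cs = {}"
      using inj_on_image_Int[OF inj_on_col_label[OF T], of "{..<length (T ! 0)} - C" cs] cs C by blast
    moreover have "row_label T ` ({1..<length T} - R) \<subseteq> row_labels T"
      by (auto simp: row_labels_def)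
    ultimately show ?thesis
      using A_labels unfolding set_w set_A by blast
  qed
  moreover have "set w \<inter> set B = {}"
  proof -
    have "{1..<length T} - R \<subseteq> {..<length T}" "rs \<subseteq> {..<length T}" "({1..<length T} - R) \<inter> rs = {}"
      using rs R by auto
    then have "row_label T ` ({1..<length T} - R) \<inter> row_label T ` rs = {}"
      using inj_on_image_Int[OF inj_on_row_label[OF T]] by (metis image_empty)
    moreover have "col_label T ` ({..<length (T ! 0)} - C) \<inter> row_labels T = {}"
      using col_label_notin_row_labels[OF T] by blast
    ultimately show ?thesis
      using B_labels unfolding set_w set_B by blast
  qed
  ultimately have dist': "distinct (w @ A @ B)"
    using dist by auto

  have "\<forall>i\<in>R - rs. \<exists>j\<in>C - cs. j < length (T ! i) \<and> T ! i ! j = 0"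
    by (auto simp: rs_def)
  moreover have "\<forall>j\<in>C - cs. (\<forall>i\<in>R - rs. j < length (T ! i) \<longrightarrow> T ! i ! j \<noteq> 1) \<longrightarrow>
      last (0 # w @ A @ B) < col_label T j"
    by (intro ballI impI, rule next_seam)
  moreover have "R - rs \<subseteq> {1..<length T}" "C - cs \<subseteq> {..<length (T ! 0)}"
    using R C by blast+
  ultimately show "psi_inv T (psi_step T (R, C, w))"
    unfolding step psi_inv_def prod.case using succ' dist' set_w' by (intro conjI)
qed

lemma psi_inv_Psi:
  assumes "ew_tableau T"
  shows "psi_inv T ({}, {}, Psi T)"
proof -
  let ?s = "while (\<lambda>(R, C, w). R \<noteq> {} \<or> C \<noteq> {}) (psi_step T)
              ({1..<length T}, {..<length (T ! 0)}, [])"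
  let ?r = "measure (\<lambda>(R, C, w). card R + card C)"
  have step: "psi_inv T (psi_step T s) \<and> (psi_step T s, s) \<in> ?r"
    if "psi_inv T s" "case s of (R, C, w) \<Rightarrow> R \<noteq> {} \<or> C \<noteq> {}" for s
    using psi_inv_step[OF assms, of "fst s" "fst (snd s)" "snd (snd s)"] that
    by (simp add: case_prod_beta del: in_measure)
  have "case ?s of (R, C, w) \<Rightarrow> R = {} \<and> C = {} \<and> psi_inv T (R, C, w)"
  proof (rule while_rule[where P = "psi_inv T" and r = ?r])
    show "psi_inv T ({1..<length T}, {..<length (T ! 0)}, [])"
      by (rule psi_inv_init[OF assms])
  qed (use step in \<open>auto simp del: in_measure\<close>)
  then show ?thesis
    by (auto simp: Psi_def)
qed

lemma distinct_Psi: "ew_tableau T \<Longrightarrow> distinct (Psi T)"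
  using psi_inv_Psi[of T] by (simp add: psi_inv_def)

lemma set_Psi: "ew_tableau T \<Longrightarrow> set (Psi T) = {1..ew_size T}"
  using psi_inv_Psi[of T] nonzero_labels_eq[of T] by (simp add: psi_inv_def)

lemma descent_bottoms_Psi:
  assumes "ew_tableau T"
  shows "descent_bottoms (Psi T) = row_labels T - {0}"
proof -
  let ?w = "Psi T"
  have step: "letter ?w i > letter ?w (Suc i) \<longleftrightarrow> letter ?w (Suc i) \<in> row_labels T - {0}"
    if "i < length ?w" for i
    using psi_inv_Psi[OF assms] that
    by (auto simp: psi_inv_def successively_conv_nth letter_def simp del: successively.simps)
  have sub: "row_labels T - {0} \<subseteq> set ?w"
    using psi_inv_Psi[OF assms] row_labels_nonzero[OF assms] by (auto simp: psi_inv_def)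
  have occurs: "\<exists>i<length ?w. b = letter ?w (Suc i)" if "b \<in> row_labels T - {0}" for b
  proof -
    have "b \<in> set ?w"
      using sub that by blast
    then show ?thesis
      by (auto simp: letter_def in_set_conv_nth)
  qed
  show ?thesis
  proof (intro equalityI subsetI)
    fix b assume "b \<in> descent_bottoms ?w"
    then show "b \<in> row_labels T - {0}"
      using step by (auto simp: descent_bottoms_def)
  next
    fix b assume b: "b \<in> row_labels T - {0}"
    then obtain i where i: "i < length ?w" "b = letter ?w (Suc i)"
      using occurs by blast
    then have less: "letter ?w i > letter ?w (Suc i)"
      using step b by simp
    then have "i \<noteq> 0"
      by (auto simp: letter_def intro: ccontr)
    then show "b \<in> descent_bottoms ?w"
      using i less unfolding descent_bottoms_def by (auto intro!: exI[of _ i])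
  qed
qed

section \<open>The bijection \<open>DE\<close>\<close>

text \<open>
  \<open>DE_pos p i\<close> is the letter at position \<open>DE_src p i\<close>. Passing to positions makes injectivity a
  matter of comparing indices.
\<close>

definition DE_src :: "nat list \<Rightarrow> nat \<Rightarrow> nat" where
  "DE_src p i =
     (if \<exists>j. i < j \<and> j \<le> length p \<and> letter p i > letter p j
      then i + 1 else Max {k. k < i \<and> letter p k < letter p i} + 1)"

lemma DE_pos_eq_letter: "DE_pos p i = letter p (DE_src p i)"
  by (auto simp: DE_pos_def DE_src_def)

lemma letter_in_set: "1 \<le> i \<Longrightarrow> i \<le> length p \<Longrightarrow> letter p i \<in> set p"
  by (cases i) (auto simp: letter_def)

lemma letter_inj:
  assumes "distinct p" "0 \<notin> set p"
  shows "inj_on (letter p) {0..length p}"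
proof -
  have "distinct (0 # p)"
    using assms by simp
  then show ?thesis
    unfolding inj_on_def letter_def by (metis atLeastAtMost_iff le_imp_less_Suc length_Cons nth_eq_iff_index_eq)
qed

text \<open>The position \<open>0\<close> always is a candidate, as its letter \<open>0\<close> is below all others.\<close>

lemma rightmost_smaller:
  assumes "0 \<notin> set p" "1 \<le> i" "i \<le> length p"
  defines "k \<equiv> Max {k. k < i \<and> letter p k < letter p i}"
  shows "k < i" "letter p k < letter p i" "\<And>l. k < l \<Longrightarrow> l < i \<Longrightarrow> letter p i \<le> letter p l"
proof -
  let ?K = "{k. k < i \<and> letter p k < letter p i}"
  have "letter p i \<noteq> 0"
    using letter_in_set[OF assms(2,3)] assms(1) by metis
  then have "0 \<in> ?K"
    using assms(2) by (simp add: letter_def[of p 0])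
  then have "k \<in> ?K"
    unfolding k_def by (intro Max_in) auto
  then show "k < i" "letter p k < letter p i"
    by auto
  show "letter p i \<le> letter p l" if "k < l" "l < i" for l
    using Max_ge[of ?K l] that unfolding k_def[symmetric] by (auto simp: not_less[symmetric])
qed

text \<open>
  Positions with a smaller letter to their right move on by one. For two positions \<open>i < i'\<close> without
  one, the letter at \<open>i\<close> is smaller than that at \<open>i'\<close>, so the rightmost smaller position \<open>k'\<close> of
  \<open>i'\<close> satisfies \<open>k < i \<le> k'\<close>. In the mixed case, \<open>i\<close> would be the rightmost position before \<open>i'\<close> with a
  letter below that of \<open>i'\<close>, and the still smaller letter to the right of \<open>i\<close> could be neither
  before nor after \<open>i'\<close>.
\<close>

lemma inj_on_DE_src:
  assumes "distinct p" "0 \<notin> set p"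
  shows "inj_on (DE_src p) {1..length p}"
proof -
  let ?low = "\<lambda>i. \<exists>j. i < j \<and> j \<le> length p \<and> letter p i > letter p j"
  let ?k = "\<lambda>i. Max {k. k < i \<and> letter p k < letter p i}"
  note k = rightmost_smaller[OF assms(2)]
  have mixed: "i \<noteq> ?k i'" if "1 \<le> i'" "i' \<le> length p" "?low i" "\<not> ?low i'" for i i'
  proof
    assume i: "i = ?k i'"
    obtain j where j: "i < j" "j \<le> length p" "letter p j < letter p i"
      using \<open>?low i\<close> by blast
    have less: "letter p j < letter p i'"
      using j k(2)[of i'] that i by simp
    consider "j < i'" | "j = i'" | "i' < j"
      by linarith
    then show False
    proof cases
      case 1
      then show False
        using k(3)[of i' j] that(1,2) j(1) less i by simp
    next
      case 2
      then show False
        using less by simp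
    next
      case 3
      then show False
        using that(4) j(2) less by blast
    qed
  qed
  have minima: "?k i < ?k i'"
    if "1 \<le> i" "i < i'" "i' \<le> length p" "\<not> ?low i" for i i'
  proof -
    have "letter p i \<noteq> letter p i'"
      using inj_onD[OF letter_inj[OF assms], of i i'] that by auto
    then have "letter p i < letter p i'"
      using that by (meson linorder_neqE_nat)
    then have "i \<le> ?k i'"
      using k(3)[of i' i] that by (meson leD leI order_trans less_imp_le)
    then show ?thesis
      using k(1)[of i] that by simp
  qed
  show ?thesis
  proof (rule linorder_inj_onI')
    fix i i' assume i: "i \<in> {1..length p}" "i' \<in> {1..length p}" "i < i'"
    then show "DE_src p i \<noteq> DE_src p i'"
      using mixed[of i' i] mixed[of i i'] minima[of i i'] by (auto simp: DE_src_def)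
  qed
qed

lemma DE_src_range:
  assumes "0 \<notin> set p" "i \<in> {1..length p}"
  shows "DE_src p i \<in> {1..length p}"
  using rightmost_smaller(1)[OF assms(1), of i] assms(2) by (auto simp: DE_src_def)

lemma bij_betw_DE_pos:
  assumes "distinct p" "set p = {1..length p}"
  shows "bij_betw (DE_pos p) {1..length p} {1..length p}"
proof -
  let ?N = "{1..length p}"
  have p0: "0 \<notin> set p"
    using assms(2) by simp
  have "inj_on (letter p) ?N"
    using letter_inj[OF assms(1) p0] by (rule inj_on_subset) auto
  moreover have sub: "DE_src p ` ?N \<subseteq> ?N"
    using DE_src_range[OF p0] by blast
  ultimately have "inj_on (letter p \<circ> DE_src p) ?N"
    using inj_on_DE_src[OF assms(1) p0] by (meson comp_inj_on inj_on_subset)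
  moreover have "DE_pos p = letter p \<circ> DE_src p"
    by (auto simp: DE_pos_eq_letter)
  moreover have "letter p i \<in> ?N" if "i \<in> ?N" for i
    using letter_in_set[of i p] that assms(2) by auto
  ultimately show ?thesis
    using sub by (intro bij_betw_imageI endo_inj_surj) auto
qed

lemma letter_DE:
  assumes "distinct p" "set p = {1..length p}" "i \<in> {1..length p}"
  shows "letter (DE p) (DE_pos p i) = letter p i"
proof -
  have m: "DE_pos p i \<in> {1..length p}"
    using bij_betw_DE_pos[OF assms(1,2)] assms(3) by (rule bij_betw_apply)
  have "(THE b. \<exists>i'. 1 \<le> i' \<and> i' \<le> length p \<and> DE_pos p i' = DE_pos p i \<and> b = letter p i') = letter p i"
  proof (rule the_equality)
    fix b assume "\<exists>i'. 1 \<le> i' \<and> i' \<le> length p \<and> DE_pos p i' = DE_pos p i \<and> b = letter p i'"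
    then show "b = letter p i"
      using inj_onD[OF bij_betw_imp_inj_on[OF bij_betw_DE_pos[OF assms(1,2)]], of _ i] assms(3)
      by auto
  qed (use assms(3) in auto)
  then show ?thesis
    using m by (cases "DE_pos p i") (auto simp: DE_def letter_def[of "map _ _"] nth_append simp del: upt_Suc)
qed

text \<open>
  In the case of a right-to-left minimum \<open>a\<^sub>i\<close>, the letter after the rightmost smaller position is
  \<open>a\<^sub>i\<close> itself or lies between the two, where no letter is smaller than \<open>a\<^sub>i\<close>.
\<close>

lemma DE_pos_less_iff_descent:
  assumes "0 \<notin> set p" "i \<in> {1..length p}"
  shows "DE_pos p i < letter p i \<longleftrightarrow>
         i < length p \<and> letter p (i + 1) < letter p i"
proof (cases "\<exists>j. i < j \<and> j \<le> length p \<and> letter p i > letter p j")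
  case True
  then show ?thesis
    by (auto simp: DE_pos_def)
next
  case False
  define k where "k = Max {k. k < i \<and> letter p k < letter p i}"
  have "k < i" and max: "\<And>l. k < l \<Longrightarrow> l < i \<Longrightarrow> letter p i \<le> letter p l"
    using rightmost_smaller[OF assms(1), of i] assms(2) by (auto simp: k_def)
  then have "letter p i \<le> letter p (k + 1)"
    using max[of "k + 1"] by (cases "k + 1 = i") auto
  then have "\<not> DE_pos p i < letter p i"
    using False by (auto simp: DE_pos_def k_def)
  then show ?thesis
    using False by (auto intro: Suc_leI)
qed

theorem excedance_bottoms_DE:
  assumes "distinct p" "set p = {1..length p}"
  shows "excedance_bottoms (DE p) = descent_bottoms p"
proof -
  let ?N = "{1..length p}"
  have p0: "0 \<notin> set p"
    using assms(2) by simp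
  have "length (DE p) = length p"
    by (simp add: DE_def del: upt_Suc)
  then have "excedance_bottoms (DE p) = {m \<in> DE_pos p ` ?N. m < letter (DE p) m}"
    using bij_betw_imp_surj_on[OF bij_betw_DE_pos[OF assms]] by (auto simp: excedance_bottoms_def)
  also have "\<dots> = DE_pos p ` {i \<in> ?N. DE_pos p i < letter p i}"
    using letter_DE[OF assms] by auto
  also have "\<dots> = DE_pos p ` {i \<in> ?N. i < length p \<and> letter p (i + 1) < letter p i}"
    using DE_pos_less_iff_descent[OF p0] by (intro arg_cong[where f = "image _"]) blast
  also have "\<dots> = (\<lambda>i. letter p (i + 1)) ` {i \<in> ?N. i < length p \<and> letter p (i + 1) < letter p i}"
    \<comment> \<open>At a descent, the next letter is the smaller letter to the right that the definition asks for.\<close>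
    by (intro image_cong) (auto simp: DE_pos_def dest!: spec[of _ "Suc _"])
  also have "\<dots> = descent_bottoms p"
    by (auto simp: descent_bottoms_def)
  finally show ?thesis .
qed

section \<open>Row labels as descent and excedance bottoms\<close>

theorem proposition2p5:
  fixes n :: nat and T :: "nat list list" and \<pi> :: "nat list"
  assumes "n \<ge> 1"
    and "ew_tableau T"
    and "ew_size T = n"
    and "\<pi> = Psi T"
  shows "row_labels T - {0} = descent_bottoms \<pi> \<and>
         row_labels T - {0} = excedance_bottoms (DE \<pi>)"
proof -
  have perm: "distinct \<pi>" "set \<pi> = {1..n}"
    using distinct_Psi[OF assms(2)] set_Psi[OF assms(2)] assms(3,4) by auto
  then have "length \<pi> = n"
    using distinct_card by fastforce
  then show ?thesis
    using descent_bottoms_Psi[OF assms(2)] excedance_bottoms_DE[of \<pi>] perm assms(4) by simp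
qed

end
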